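(* Let $k\ge1$, let $C=(c_{i,j})$ be a $k\times k$ complex matrix, let $\gamma\in(0,\infty)$, and for $N>k$ put $\delta:=\gamma^N$ and $A:=J+\delta K$, where $J$ is the $N\times N$ Jordan matrix and $K$ is the $N\times N$ matrix having $C$ as its bottom left-hand $k\times k$ corner and zeros elsewhere. Then, provided $N$ is large enough, $$\mathrm{Spec}(A)=\{\gamma z: z^N=f(z)\},$$ where $$f(z):=\sum_{r=0}^{2k-2}b_rz^r,\qquad b_r:=\gamma^r\sum_{k-i+j=r+1}c_{i,j},$$ the last sum being over all $i,j\in\{1,\dots,k\}$ with $k-i+j=r+1$.
   Context: $J$ is the $N\times N$ Jordan matrix with $J_{r,s}=1$ if $s=r+1$ and $J_{r,s}=0$ otherwise. In block form $K=\begin{pmatrix}0&0\\ C&0\end{pmatrix}$, where the (zero) top right block has size $(N-k)\times(N-k)$; thus $K_{N-k+i,\,j}=c_{i,j}$ for $1\le i,j\le k$. $\mathrm{Spec}$ denotes the spectrum (set of eigenvalues) of a matrix. *)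

theory Defs
  imports "Jordan_Normal_Form.Spectral_Radius"
begin

text \<open>
  Matrices are indexed from 0 in the library, so the entry written \<open>c\<^sub>i\<^sub>,\<^sub>j\<close> with
  \<open>1 \<le> i, j \<le> k\<close> is \<open>C $$ (i - 1, j - 1)\<close>.
\<close>

text \<open>The top right zero block is square of size \<open>N - k\<close>; intended for \<open>N > k\<close>.\<close>

definition corner_mat :: "nat \<Rightarrow> nat \<Rightarrow> complex mat \<Rightarrow> complex mat" where
  "corner_mat N k C =
     four_block_mat (0\<^sub>m (N - k) k) (0\<^sub>m (N - k) (N - k)) C (0\<^sub>m k (N - k))"

definition perturbed_jordan :: "nat \<Rightarrow> nat \<Rightarrow> complex mat \<Rightarrow> real \<Rightarrow> complex mat" where
  "perturbed_jordan N k C \<delta> =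
     jordan_block N 0 + complex_of_real \<delta> \<cdot>\<^sub>m corner_mat N k C"

text \<open>For \<open>i \<le> k\<close> the natural-number subtraction \<open>k - i\<close> is exact.\<close>

definition b_coeff :: "nat \<Rightarrow> complex mat \<Rightarrow> real \<Rightarrow> nat \<Rightarrow> complex" where
  "b_coeff k C \<gamma> r = complex_of_real \<gamma> ^ r *
     (\<Sum>(i, j) | i \<in> {1..k} \<and> j \<in> {1..k} \<and> k - i + j = r + 1. C $$ (i - 1, j - 1))"

definition f_fun :: "nat \<Rightarrow> complex mat \<Rightarrow> real \<Rightarrow> complex \<Rightarrow> complex" where
  "f_fun k C \<gamma> z = (\<Sum>r = 0..2 * k - 2. b_coeff k C \<gamma> r * z ^ r)"

end

theory Submission
  imports Defs
begin

text \<open>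
  Let \<open>A = J + \<delta> K\<close> and let \<open>\<mu>\<close> be a complex number. Each row of \<open>A v = \<mu> v\<close> but
  the last expresses the next coordinate of \<open>v\<close> by earlier ones, so an eigenvector can be computed
  from the top: the first
  \<open>N - k\<close> rows only involve \<open>J\<close> and give \<open>v\<^sub>m = \<mu>\<^sup>m v\<^sub>0\<close> for \<open>m \<le> N - k\<close>. As soon as
  \<open>k \<le> N - k\<close>, the corner block \<open>C\<close> only sees these geometric coordinates, so each of the last
  \<open>k\<close> rows adds a known inhomogeneity to the recursion \<open>v\<^sub>m\<^sub>+\<^sub>1 = \<mu> v\<^sub>m\<close>, whose solution is
  explicit (\<open>shoot\<close>). Hence \<open>v\<close> is determined up to the factor \<open>v\<^sub>0\<close>, and the last row is
  the only remaining constraint: the recursion must reach the value \<open>0\<close> at the fictitious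
  coordinate \<open>N\<close>. This is the equation
  \<open>\<mu>\<^sup>N = \<delta> \<Sum>\<^sub>i\<^sub>,\<^sub>j c\<^sub>i\<^sub>j \<mu>\<^bsup>k-1-i+j\<^esup>\<close>, with \<open>i, j < k\<close>
  (\<open>eigenvalue_perturbed_jordan_iff\<close>). For \<open>\<mu> = \<gamma> z\<close> and \<open>\<delta> = \<gamma>\<^sup>N\<close> the factor \<open>\<gamma>\<^sup>N\<close> cancels, and
  collecting equal powers of \<open>z\<close> on the right gives \<open>z\<^sup>N = f z\<close> (\<open>f_fun_eq_double_sum\<close>).
\<close>

text \<open>
  The solution of the recursion \<open>x\<^sub>m\<^sub>+\<^sub>1 = \<mu> x\<^sub>m\<close> with \<open>x\<^sub>0 = 1\<close>, where from step \<open>n\<close> on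
  a forcing term \<open>g 0, g 1, \<dots>\<close> is subtracted. Truncated subtraction makes the sum empty for
  \<open>m \<le> n\<close>.
\<close>

definition shoot :: "nat \<Rightarrow> (nat \<Rightarrow> complex) \<Rightarrow> complex \<Rightarrow> nat \<Rightarrow> complex" where
  "shoot n g \<mu> m = \<mu> ^ m - (\<Sum>i<m - n. \<mu> ^ (m - n - 1 - i) * g i)"

lemma shoot_geometric: "m \<le> n \<Longrightarrow> shoot n g \<mu> m = \<mu> ^ m"
  by (simp add: shoot_def)

lemma shoot_Suc:
  "shoot n g \<mu> (Suc m) = \<mu> * shoot n g \<mu> m - (if n \<le> m then g (m - n) else 0)"
proof (cases "n \<le> m")
  case True
  have "(\<Sum>i<m - n. \<mu> ^ (m - n - i) * g i) = \<mu> * (\<Sum>i<m - n. \<mu> ^ (m - n - 1 - i) * g i)"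
    unfolding sum_distrib_left
  proof (rule sum.cong)
    fix i assume "i \<in> {..<m - n}"
    then have "m - n - i = Suc (m - n - 1 - i)" by auto
    then show "\<mu> ^ (m - n - i) * g i = \<mu> * (\<mu> ^ (m - n - 1 - i) * g i)" by simp
  qed simp
  with True show ?thesis
    by (simp add: shoot_def Suc_diff_le algebra_simps)
next
  case False
  then show ?thesis by (simp add: shoot_def)
qed

lemma perturbed_jordan_mult_vec_nth:
  assumes C: "C \<in> carrier_mat k k" and v: "v \<in> carrier_vec N" and kN: "k \<le> N" and m: "m < N"
  shows "(perturbed_jordan N k C \<delta> *\<^sub>v v) $ m =
    (if Suc m < N then v $ Suc m else 0) +
    (if N - k \<le> m then complex_of_real \<delta> * (\<Sum>j<k. C $$ (m - (N - k), j) * v $ j) else 0)"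
proof -
  have K: "corner_mat N k C \<in> carrier_mat N N"
  proof -
    have "corner_mat N k C \<in> carrier_mat (N - k + k) (k + (N - k))"
      unfolding corner_mat_def by (rule four_block_carrier_mat) auto
    then show ?thesis using kN by simp
  qed
  have K_entry: "corner_mat N k C $$ (m, j) =
      (if j < k \<and> N - k \<le> m then C $$ (m - (N - k), j) else 0)" if "j < N" for j
    using that m kN C unfolding corner_mat_def by (subst index_mat_four_block) auto
  have "(perturbed_jordan N k C \<delta> *\<^sub>v v) $ m =
      (\<Sum>j<N. perturbed_jordan N k C \<delta> $$ (m, j) * v $ j)"
    using K v m
    by (auto simp: perturbed_jordan_def scalar_prod_def atLeast0LessThan intro!: sum.cong)
  also have "\<dots> = (\<Sum>j<N. (if j = Suc m then v $ j else 0) +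
      (if j < k \<and> N - k \<le> m then complex_of_real \<delta> * (C $$ (m - (N - k), j) * v $ j) else 0))"
    using K m by (intro sum.cong) (auto simp: perturbed_jordan_def K_entry algebra_simps)
  also have "\<dots> = (\<Sum>j<N. if j = Suc m then v $ j else 0) +
      (\<Sum>j<N. if j < k \<and> N - k \<le> m
         then complex_of_real \<delta> * (C $$ (m - (N - k), j) * v $ j) else 0)"
    by (rule sum.distrib)
  also have "(\<Sum>j<N. if j = Suc m then v $ j else 0) = (if Suc m < N then v $ Suc m else 0)"
    by (simp add: sum.delta)
  also have "(\<Sum>j<N. if j < k \<and> N - k \<le> m
         then complex_of_real \<delta> * (C $$ (m - (N - k), j) * v $ j) else 0) =
      (if N - k \<le> m then complex_of_real \<delta> * (\<Sum>j<k. C $$ (m - (N - k), j) * v $ j) else 0)"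
  proof -
    have "(\<Sum>j<N. if j < k then h j else 0) = (\<Sum>j<k. h j)" for h :: "nat \<Rightarrow> complex"
      by (rule sum.mono_neutral_cong_right) (use kN in auto)
    then show ?thesis by (simp add: sum_distrib_left)
  qed
  finally show ?thesis .
qed

lemma perturbed_jordan_carrier:
  assumes "C \<in> carrier_mat k k" "k \<le> N"
  shows "perturbed_jordan N k C \<delta> \<in> carrier_mat N N"
  using assms by (auto simp: perturbed_jordan_def corner_mat_def)

text \<open>
  The hypothesis \<open>2 * k \<le> N\<close> guarantees that the corner block acts on coordinates that are still
  in the geometric range of the recursion.
\<close>

lemma eigenvalue_perturbed_jordan_iff:
  assumes C: "C \<in> carrier_mat k k" and N: "2 * k \<le> N" "0 < N"
  shows "eigenvalue (perturbed_jordan N k C \<delta>) \<mu> \<longleftrightarrow>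
    \<mu> ^ N = complex_of_real \<delta> * (\<Sum>i<k. \<Sum>j<k. C $$ (i, j) * \<mu> ^ (k - 1 - i + j))"
    (is "_ \<longleftrightarrow> ?char")
proof -
  let ?A = "perturbed_jordan N k C \<delta>"
  let ?n = "N - k"
  define g where "g i = complex_of_real \<delta> * (\<Sum>j<k. C $$ (i, j) * \<mu> ^ j)" for i
  define w where "w = shoot ?n g \<mu>"
  have kN: "k \<le> N" and kn: "k \<le> ?n" and Nn: "N - ?n = k" using N by auto
  have A: "?A \<in> carrier_mat N N" by (rule perturbed_jordan_carrier[OF C kN])
  have char: "?char \<longleftrightarrow> w N = 0"
  proof -
    have "(\<Sum>i<k. \<mu> ^ (k - 1 - i) * g i) =
        complex_of_real \<delta> * (\<Sum>i<k. \<Sum>j<k. C $$ (i, j) * \<mu> ^ (k - 1 - i + j))"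
      unfolding g_def sum_distrib_left
      by (intro sum.cong refl) (simp only: power_add mult.assoc mult.commute mult.left_commute)
    then show ?thesis by (simp add: w_def shoot_def Nn)
  qed
  have ext: "eigenvector ?A v \<mu> \<longleftrightarrow> v \<noteq> 0\<^sub>v N \<and> (\<forall>m<N. (?A *\<^sub>v v) $ m = \<mu> * v $ m)"
    if "v \<in> carrier_vec N" for v
    using A that by (auto simp: eigenvector_def vec_eq_iff)
  show ?thesis
  proof
    assume "eigenvalue ?A \<mu>"
    then obtain v where ev: "eigenvector ?A v \<mu>" by (auto simp: eigenvalue_def)
    have v: "v \<in> carrier_vec N" using ev A by (auto simp: eigenvector_def)
    \<comment> \<open>Padding by the fictitious coordinate \<open>N\<close> lets the last row take the form of the others.\<close>
    define u where "u m = (if m < N then v $ m else 0)" for m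
    have step: "u (Suc m) = \<mu> * u m -
        (if ?n \<le> m then complex_of_real \<delta> * (\<Sum>j<k. C $$ (m - ?n, j) * u j) else 0)"
      if "m < N" for m
    proof -
      have "(\<Sum>j<k. C $$ (m - ?n, j) * v $ j) = (\<Sum>j<k. C $$ (m - ?n, j) * u j)"
        using kN by (intro sum.cong) (auto simp: u_def)
      moreover have "(?A *\<^sub>v v) $ m = \<mu> * v $ m" using ev ext[OF v] that by blast
      ultimately show ?thesis
        using perturbed_jordan_mult_vec_nth[OF C v kN that, of \<delta>] that
        by (auto simp: u_def eq_diff_eq)
    qed
    have geom: "u m = u 0 * \<mu> ^ m" if "m \<le> ?n" for m
      using that
    proof (induction m)
      case (Suc m)
      then show ?case using step[of m] by simp
    qed simp
    have u_eq: "u m = u 0 * w m" if "m \<le> N" for m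
      using that
    proof (induction m)
      case 0
      then show ?case by (simp add: w_def shoot_geometric)
    next
      case (Suc m)
      have "complex_of_real \<delta> * (\<Sum>j<k. C $$ (m - ?n, j) * u j) = u 0 * g (m - ?n)"
      proof -
        have "(\<Sum>j<k. C $$ (m - ?n, j) * u j) = (\<Sum>j<k. u 0 * (C $$ (m - ?n, j) * \<mu> ^ j))"
        proof (rule sum.cong)
          fix j assume "j \<in> {..<k}"
          then have "u j = u 0 * \<mu> ^ j" using kn by (intro geom) auto
          then show "C $$ (m - ?n, j) * u j = u 0 * (C $$ (m - ?n, j) * \<mu> ^ j)"
            by (metis mult.left_commute)
        qed simp
        then show ?thesis by (simp add: g_def sum_distrib_left ac_simps)
      qed
      moreover have "u m = u 0 * w m" using Suc by simp
      ultimately have "u (Suc m) = \<mu> * (u 0 * w m) - (if ?n \<le> m then u 0 * g (m - ?n) else 0)"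
        using step[of m] Suc.prems by simp
      also have "\<dots> = u 0 * w (Suc m)"
        by (simp add: w_def shoot_Suc right_diff_distrib)
      finally show ?case .
    qed
    have "u 0 \<noteq> 0"
    proof
      assume "u 0 = 0"
      then have "v $ m = 0" if "m < N" for m using u_eq[of m] that by (simp add: u_def)
      then have "v = 0\<^sub>v N" using v by (intro eq_vecI) auto
      then show False using ev ext[OF v] by blast
    qed
    moreover have "u N = 0" by (simp add: u_def)
    ultimately show ?char using u_eq[of N] char by simp
  next
    assume ?char
    then have wN: "w N = 0" using char by simp
    define v where "v = vec N w"
    have v: "v \<in> carrier_vec N" by (simp add: v_def)
    have "v $ 0 = 1" using N by (simp add: v_def w_def shoot_geometric)
    then have "v \<noteq> 0\<^sub>v N" using N by auto
    moreover have "(?A *\<^sub>v v) $ m = \<mu> * v $ m" if m: "m < N" for m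
    proof -
      have "complex_of_real \<delta> * (\<Sum>j<k. C $$ (m - ?n, j) * v $ j) = g (m - ?n)"
      proof -
        have "(\<Sum>j<k. C $$ (m - ?n, j) * v $ j) = (\<Sum>j<k. C $$ (m - ?n, j) * \<mu> ^ j)"
          using kn kN by (intro sum.cong) (auto simp: v_def w_def shoot_geometric)
        then show ?thesis by (simp add: g_def)
      qed
      moreover have "(if Suc m < N then v $ Suc m else 0) = w (Suc m)"
        using m wN by (cases "Suc m = N") (auto simp: v_def)
      ultimately have "(?A *\<^sub>v v) $ m = w (Suc m) + (if ?n \<le> m then g (m - ?n) else 0)"
        using perturbed_jordan_mult_vec_nth[OF C v kN m, of \<delta>] by simp
      also have "\<dots> = \<mu> * v $ m" using m by (simp add: w_def v_def shoot_Suc)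
      finally show ?thesis .
    qed
    ultimately have "eigenvector ?A v \<mu>" using ext[OF v] by blast
    then show "eigenvalue ?A \<mu>" by (auto simp: eigenvalue_def)
  qed
qed

text \<open>
  The coefficient \<open>b_coeff k C \<gamma> r\<close> collects the entries of one diagonal of \<open>C\<close>; every entry lies
  on exactly one of the diagonals \<open>r = 0, \<dots>, 2 * k - 2\<close>.
\<close>

lemma f_fun_eq_double_sum:
  "f_fun k C \<gamma> z =
    (\<Sum>i<k. \<Sum>j<k. C $$ (i, j) * (complex_of_real \<gamma> * z) ^ (k - 1 - i + j))"
proof -
  let ?x = "complex_of_real \<gamma> * z"
  let ?S = "{1..k} \<times> {1..k}"
  define d where "d = (\<lambda>(i, j). k - i + j - 1 :: nat)"
  have diag: "{p. case p of (i, j) \<Rightarrow> i \<in> {1..k} \<and> j \<in> {1..k} \<and> k - i + j = r + 1} =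
      {p \<in> ?S. d p = r}" for r
    by (auto simp: d_def)
  have "f_fun k C \<gamma> z =
      (\<Sum>r = 0..2 * k - 2. \<Sum>p\<in>{p \<in> ?S. d p = r}. case p of (i, j) \<Rightarrow> C $$ (i - 1, j - 1) * ?x ^ d p)"
    unfolding f_fun_def b_coeff_def diag
    by (intro sum.cong) (auto simp: sum_distrib_left sum_distrib_right power_mult_distrib
        ac_simps intro!: sum.cong)
  also have "\<dots> = (\<Sum>p\<in>?S. case p of (i, j) \<Rightarrow> C $$ (i - 1, j - 1) * ?x ^ d p)"
    by (rule sum.group) (auto simp: d_def)
  also have "\<dots> = (\<Sum>p\<in>{..<k} \<times> {..<k}. case p of (i, j) \<Rightarrow> C $$ (i, j) * ?x ^ (k - 1 - i + j))"
    by (rule sum.reindex_bij_witness[where i = "map_prod Suc Suc" and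
          j = "map_prod (\<lambda>i. i - 1) (\<lambda>j. j - 1)"])
       (auto simp: d_def Suc_diff_Suc)
  also have "\<dots> = (\<Sum>i<k. \<Sum>j<k. C $$ (i, j) * ?x ^ (k - 1 - i + j))"
    by (simp only: sum.cartesian_product)
  finally show ?thesis .
qed

theorem theorem11:
  fixes k :: nat and C :: "complex mat" and \<gamma> :: real
  assumes "k \<ge> 1"
    and "C \<in> carrier_mat k k"
    and "\<gamma> > 0"
  shows "\<exists>N\<^sub>0 > k. \<forall>N \<ge> N\<^sub>0.
    spectrum (perturbed_jordan N k C (\<gamma> ^ N)) =
      {complex_of_real \<gamma> * z | z. z ^ N = f_fun k C \<gamma> z}"
proof (intro exI[of _ "2 * k"] conjI allI impI)
  show "k < 2 * k" using assms(1) by simp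
  fix N assume N: "2 * k \<le> N"
  then have N0: "0 < N" using assms(1) by simp
  have ev: "eigenvalue (perturbed_jordan N k C (\<gamma> ^ N)) (complex_of_real \<gamma> * z) \<longleftrightarrow>
      z ^ N = f_fun k C \<gamma> z" for z
    unfolding eigenvalue_perturbed_jordan_iff[OF assms(2) N N0] f_fun_eq_double_sum
    using assms(3) by (simp add: power_mult_distrib)
  have "\<mu> = complex_of_real \<gamma> * (\<mu> / complex_of_real \<gamma>)" for \<mu>
    using assms(3) by simp
  with ev show "spectrum (perturbed_jordan N k C (\<gamma> ^ N)) =
      {complex_of_real \<gamma> * z | z. z ^ N = f_fun k C \<gamma> z}"
    unfolding spectrum_def by (metis (no_types, lifting))
qed

end
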